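(* Let $L=\langle R_i:i\in I\rangle$ be a relational language, $X$ a non-empty set, $n\in\mathbb N$, $\varphi(\bar v,\tilde w)$ an $L_{\infty\omega}$-formula (with $\bar v$ a $p$-tuple and $\tilde w$ a $q$-tuple of variables) and $\mathcal T$ an $L_{\infty\omega}$-theory such that the poset $\mathbb P:=\langle\operatorname{Int}_L^{\mathcal T\cup\{\forall\bar v\,\exists_{\le n}\tilde w\,\varphi(\bar v,\tilde w)\}}(X),\subseteq\rangle$ is non-empty. Then: (a) if $\varphi(\bar v,\tilde w)\in\neg\mathcal F$ and $\mathcal T\subseteq\mathcal F$, then $\mathbb P$ is union-complete and $\operatorname{Max}\mathbb P$ is a co-dense set in $\mathbb P$ consisting of reversible interpretations; (b) if $\varphi(\bar v,\tilde w)\in\neg\mathcal G$ and $\mathcal T\subseteq\mathcal G$, then $\mathbb P$ is intersection-complete and $\operatorname{Min}\mathbb P$ is a dense set in $\mathbb P$ consisting of reversible interpretations.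
   Context: $\operatorname{ar}(R_i)=n_i$; $\operatorname{Int}_L(X)=\prod_iP(X^{n_i})$ ordered componentwise by $\subseteq$; $\operatorname{Int}^{\mathcal T}_L(X)=\{\rho:\langle X,\rho\rangle\models\mathcal T\}$. Union-/intersection-complete: closed under unions/intersections of chains. Dense (co-dense) $D$: every element is above (below) some element of $D$. Reversible: every bijective endomorphism of $\langle X,\rho\rangle$ is an automorphism. $\exists_{\le n}\tilde w\,\varphi(\bar v,\tilde w)$ denotes $\forall\tilde w^1,\dots,\tilde w^{n+1}\big(\bigvee_{k\le n+1}\neg\varphi(\bar v,\tilde w^k)\vee\bigvee_{1\le k<l\le n+1}\tilde w^k=\tilde w^l\big)$, with fresh distinct $q$-tuples $\tilde w^k$ and $\tilde w^k=\tilde w^l$ meaning the conjunction of coordinatewise equalities; so $\mathbb X\models\forall\bar v\,\exists_{\le n}\tilde w\,\varphi$ iff for each $\bar x\in X^p$ there are at most $n$ tuples $\tilde y\in X^q$ with $\mathbb X\models\varphi[\bar x,\tilde y]$. $L_{\infty\omega}$-formulas are built from atomic formulas $v_\alpha=v_\beta$, $R_i(\bar v)$ by $\neg,\forall,\exists$, and arbitrary $\bigwedge,\bigvee$. Classes: $\mathcal P$ = smallest class containing atomic formulas and all $\neg v_\alpha=v_\beta$, closed under $\forall,\exists$, arbitrary $\bigwedge,\bigvee$. $\mathcal N$ = smallest class containing all $\neg R_i(\bar v)$, $v_\alpha=v_\beta$, $\neg v_\alpha=v_\beta$, closed under $\forall,\exists$, arbitrary $\bigwedge,\bigvee$. $\mathcal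 F$ = smallest class containing $\mathcal P$ and all $\neg R_i(\bar v)$, closed under $\forall$, arbitrary $\bigwedge$, finite $\bigvee$. $\mathcal G$ = smallest class containing $\mathcal N$ and all $R_i(\bar v)$, closed under $\forall$, arbitrary $\bigwedge$, finite $\bigvee$. $\neg\mathcal F$ = smallest class containing $\mathcal N$ and all $R_i(\bar v)$, closed under $\exists$, arbitrary $\bigvee$, finite $\bigwedge$. $\neg\mathcal G$ = smallest class containing $\mathcal P$ and all $\neg R_i(\bar v)$, closed under $\exists$, arbitrary $\bigvee$, finite $\bigwedge$. *)

theory Defs
  imports Main "HOL-Library.FuncSet"
begin

text \<open>
  Formulas of \<open>L\<^sub>\<infinity>\<^sub>\<omega>\<close> with variables in \<open>'v\<close> and relation symbols in \<open>'i\<close>.  \<open>Conj J F\<close> and \<open>Disj J F\<close>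
  are the conjunction and disjunction of the family \<open>F j\<close>, \<open>j \<in> J\<close> (values of \<open>F\<close> outside \<open>J\<close> are
  irrelevant).  Every set of formulas of \<open>L\<^sub>\<infinity>\<^sub>\<omega>\<close> only uses families of bounded cardinality, so
  letting \<open>'k\<close> range over all types covers arbitrary conjunctions and disjunctions; the summand
  \<open>nat\<close> guarantees that all finite ones are available whatever \<open>'k\<close> is.
  The map function \<open>rename f\<close> applies \<open>f\<close> to all variables, free and bound, including the variables
  attached to quantifiers.
\<close>

datatype (dead 'i, 'v, dead 'k) fm =
    Eq 'v 'v
  | Rel 'i "'v list"
  | Neg "('i, 'v, 'k) fm"
  | All 'v "('i, 'v, 'k) fm"
  | Ex 'v "('i, 'v, 'k) fm"
  | Conj "(nat + 'k) set" "nat + 'k \<Rightarrow> ('i, 'v, 'k) fm"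
  | Disj "(nat + 'k) set" "nat + 'k \<Rightarrow> ('i, 'v, 'k) fm"
  for map: rename

primrec fv :: "('i, 'v, 'k) fm \<Rightarrow> 'v set" where
  "fv (Eq a b) = {a, b}"
| "fv (Rel i vs) = set vs"
| "fv (Neg \<phi>) = fv \<phi>"
| "fv (All v \<phi>) = fv \<phi> - {v}"
| "fv (Ex v \<phi>) = fv \<phi> - {v}"
| "fv (Conj J F) = (\<Union>j\<in>J. fv (F j))"
| "fv (Disj J F) = (\<Union>j\<in>J. fv (F j))"

text \<open>The language has the relation symbols \<open>R\<^sub>i\<close>, \<open>i \<in> I\<close>, of arity \<open>ar i\<close>.\<close>

inductive_set formulas :: "'i set \<Rightarrow> ('i \<Rightarrow> nat) \<Rightarrow> ('i, 'v, 'k) fm set"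
  for I :: "'i set" and ar :: "'i \<Rightarrow> nat" where
  "Eq a b \<in> formulas I ar"
| "i \<in> I \<Longrightarrow> length vs = ar i \<Longrightarrow> Rel i vs \<in> formulas I ar"
| "\<phi> \<in> formulas I ar \<Longrightarrow> Neg \<phi> \<in> formulas I ar"
| "\<phi> \<in> formulas I ar \<Longrightarrow> All v \<phi> \<in> formulas I ar"
| "\<phi> \<in> formulas I ar \<Longrightarrow> Ex v \<phi> \<in> formulas I ar"
| "(\<And>j. j \<in> J \<Longrightarrow> F j \<in> formulas I ar) \<Longrightarrow> Conj J F \<in> formulas I ar"
| "(\<And>j. j \<in> J \<Longrightarrow> F j \<in> formulas I ar) \<Longrightarrow> Disj J F \<in> formulas I ar"

definition sentences :: "'i set \<Rightarrow> ('i \<Rightarrow> nat) \<Rightarrow> ('i, 'v, 'k) fm set" where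
  "sentences I ar = {\<phi> \<in> formulas I ar. fv \<phi> = {}}"

inductive_set class_P :: "'i set \<Rightarrow> ('i \<Rightarrow> nat) \<Rightarrow> ('i, 'v, 'k) fm set"
  for I :: "'i set" and ar :: "'i \<Rightarrow> nat" where
  "Eq a b \<in> class_P I ar"
| "i \<in> I \<Longrightarrow> length vs = ar i \<Longrightarrow> Rel i vs \<in> class_P I ar"
| "Neg (Eq a b) \<in> class_P I ar"
| "\<phi> \<in> class_P I ar \<Longrightarrow> All v \<phi> \<in> class_P I ar"
| "\<phi> \<in> class_P I ar \<Longrightarrow> Ex v \<phi> \<in> class_P I ar"
| "(\<And>j. j \<in> J \<Longrightarrow> F j \<in> class_P I ar) \<Longrightarrow> Conj J F \<in> class_P I ar"
| "(\<And>j. j \<in> J \<Longrightarrow> F j \<in> class_P I ar) \<Longrightarrow> Disj J F \<in> class_P I ar"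

inductive_set class_N :: "'i set \<Rightarrow> ('i \<Rightarrow> nat) \<Rightarrow> ('i, 'v, 'k) fm set"
  for I :: "'i set" and ar :: "'i \<Rightarrow> nat" where
  "i \<in> I \<Longrightarrow> length vs = ar i \<Longrightarrow> Neg (Rel i vs) \<in> class_N I ar"
| "Eq a b \<in> class_N I ar"
| "Neg (Eq a b) \<in> class_N I ar"
| "\<phi> \<in> class_N I ar \<Longrightarrow> All v \<phi> \<in> class_N I ar"
| "\<phi> \<in> class_N I ar \<Longrightarrow> Ex v \<phi> \<in> class_N I ar"
| "(\<And>j. j \<in> J \<Longrightarrow> F j \<in> class_N I ar) \<Longrightarrow> Conj J F \<in> class_N I ar"
| "(\<And>j. j \<in> J \<Longrightarrow> F j \<in> class_N I ar) \<Longrightarrow> Disj J F \<in> class_N I ar"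

inductive_set class_F :: "'i set \<Rightarrow> ('i \<Rightarrow> nat) \<Rightarrow> ('i, 'v, 'k) fm set"
  for I :: "'i set" and ar :: "'i \<Rightarrow> nat" where
  "\<phi> \<in> class_P I ar \<Longrightarrow> \<phi> \<in> class_F I ar"
| "i \<in> I \<Longrightarrow> length vs = ar i \<Longrightarrow> Neg (Rel i vs) \<in> class_F I ar"
| "\<phi> \<in> class_F I ar \<Longrightarrow> All v \<phi> \<in> class_F I ar"
| "(\<And>j. j \<in> J \<Longrightarrow> F j \<in> class_F I ar) \<Longrightarrow> Conj J F \<in> class_F I ar"
| "finite J \<Longrightarrow> (\<And>j. j \<in> J \<Longrightarrow> F j \<in> class_F I ar) \<Longrightarrow> Disj J F \<in> class_F I ar"

inductive_set class_G :: "'i set \<Rightarrow> ('i \<Rightarrow> nat) \<Rightarrow> ('i, 'v, 'k) fm set"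
  for I :: "'i set" and ar :: "'i \<Rightarrow> nat" where
  "\<phi> \<in> class_N I ar \<Longrightarrow> \<phi> \<in> class_G I ar"
| "i \<in> I \<Longrightarrow> length vs = ar i \<Longrightarrow> Rel i vs \<in> class_G I ar"
| "\<phi> \<in> class_G I ar \<Longrightarrow> All v \<phi> \<in> class_G I ar"
| "(\<And>j. j \<in> J \<Longrightarrow> F j \<in> class_G I ar) \<Longrightarrow> Conj J F \<in> class_G I ar"
| "finite J \<Longrightarrow> (\<And>j. j \<in> J \<Longrightarrow> F j \<in> class_G I ar) \<Longrightarrow> Disj J F \<in> class_G I ar"

inductive_set class_not_F :: "'i set \<Rightarrow> ('i \<Rightarrow> nat) \<Rightarrow> ('i, 'v, 'k) fm set"
  for I :: "'i set" and ar :: "'i \<Rightarrow> nat" where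
  "\<phi> \<in> class_N I ar \<Longrightarrow> \<phi> \<in> class_not_F I ar"
| "i \<in> I \<Longrightarrow> length vs = ar i \<Longrightarrow> Rel i vs \<in> class_not_F I ar"
| "\<phi> \<in> class_not_F I ar \<Longrightarrow> Ex v \<phi> \<in> class_not_F I ar"
| "(\<And>j. j \<in> J \<Longrightarrow> F j \<in> class_not_F I ar) \<Longrightarrow> Disj J F \<in> class_not_F I ar"
| "finite J \<Longrightarrow> (\<And>j. j \<in> J \<Longrightarrow> F j \<in> class_not_F I ar) \<Longrightarrow> Conj J F \<in> class_not_F I ar"

inductive_set class_not_G :: "'i set \<Rightarrow> ('i \<Rightarrow> nat) \<Rightarrow> ('i, 'v, 'k) fm set"
  for I :: "'i set" and ar :: "'i \<Rightarrow> nat" where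
  "\<phi> \<in> class_P I ar \<Longrightarrow> \<phi> \<in> class_not_G I ar"
| "i \<in> I \<Longrightarrow> length vs = ar i \<Longrightarrow> Neg (Rel i vs) \<in> class_not_G I ar"
| "\<phi> \<in> class_not_G I ar \<Longrightarrow> Ex v \<phi> \<in> class_not_G I ar"
| "(\<And>j. j \<in> J \<Longrightarrow> F j \<in> class_not_G I ar) \<Longrightarrow> Disj J F \<in> class_not_G I ar"
| "finite J \<Longrightarrow> (\<And>j. j \<in> J \<Longrightarrow> F j \<in> class_not_G I ar) \<Longrightarrow> Conj J F \<in> class_not_G I ar"

definition conj_list :: "('i, 'v, 'k) fm list \<Rightarrow> ('i, 'v, 'k) fm" where
  "conj_list \<phi>s = Conj (Inl ` {..<length \<phi>s}) (\<lambda>j. \<phi>s ! projl j)"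

definition disj_list :: "('i, 'v, 'k) fm list \<Rightarrow> ('i, 'v, 'k) fm" where
  "disj_list \<phi>s = Disj (Inl ` {..<length \<phi>s}) (\<lambda>j. \<phi>s ! projl j)"

definition Alls :: "'v list \<Rightarrow> ('i, 'v, 'k) fm \<Rightarrow> ('i, 'v, 'k) fm" where
  "Alls vs \<phi> = foldr All vs \<phi>"

text \<open>
  The permutation interchanging \<open>ws ! j\<close> and \<open>us ! j\<close>, for disjoint lists of distinct variables of
  the same length.  Renaming all (free and bound) occurrences in \<open>\<phi>\<close> along it turns \<open>\<phi>(v, w)\<close> into
  \<open>\<phi>(v, u)\<close>: when \<open>us\<close> is not free in \<open>\<phi>\<close>, the result is \<open>\<phi>\<close> with \<open>us\<close> substituted for \<open>ws\<close>, up to names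
  of bound variables, and no capture can occur.
\<close>

definition swap_vars :: "'v list \<Rightarrow> 'v list \<Rightarrow> 'v \<Rightarrow> 'v" where
  "swap_vars ws us x =
     (case map_of (zip (ws @ us) (us @ ws)) x of None \<Rightarrow> x | Some y \<Rightarrow> y)"

text \<open>
  The formula \<open>\<forall>v. \<exists>\<^sub>\<le>\<^sub>n w. \<phi>(v, w)\<close>.  Here \<open>W ! 0, \<dots>, W ! n\<close> are the \<open>n + 1\<close> tuples of fresh
  variables.
\<close>

definition fresh_copies :: "nat \<Rightarrow> 'v list \<Rightarrow> 'v list \<Rightarrow> 'v list list \<Rightarrow> bool" where
  "fresh_copies n vs ws W \<longleftrightarrow>
     length W = n + 1 \<and> (\<forall>us\<in>set W. length us = length ws) \<and> distinct (vs @ ws @ concat W)"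

definition all_at_most ::
  "nat \<Rightarrow> 'v list \<Rightarrow> 'v list \<Rightarrow> 'v list list \<Rightarrow> ('i, 'v, 'k) fm \<Rightarrow> ('i, 'v, 'k) fm" where
  "all_at_most n vs ws W \<phi> =
     Alls vs (Alls (concat W) (disj_list
       ([Neg (rename (swap_vars ws (W ! k)) \<phi>). k \<leftarrow> [0..<n + 1]] @
        [conj_list (map2 Eq (W ! k) (W ! l)). l \<leftarrow> [0..<n + 1], k \<leftarrow> [0..<l]])))"

definition tuples :: "'a set \<Rightarrow> nat \<Rightarrow> 'a list set" where
  "tuples X m = {xs. length xs = m \<and> set xs \<subseteq> X}"

definition interpretations :: "'i set \<Rightarrow> ('i \<Rightarrow> nat) \<Rightarrow> 'a set \<Rightarrow> ('i \<Rightarrow> 'a list set) set" where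
  "interpretations I ar X = (\<Pi>\<^sub>E i\<in>I. Pow (tuples X (ar i)))"

primrec sat :: "'a set \<Rightarrow> ('i \<Rightarrow> 'a list set) \<Rightarrow> ('i, 'v, 'k) fm \<Rightarrow> ('v \<Rightarrow> 'a) \<Rightarrow> bool" where
  "sat X \<rho> (Eq a b) e \<longleftrightarrow> e a = e b"
| "sat X \<rho> (Rel i vs) e \<longleftrightarrow> map e vs \<in> \<rho> i"
| "sat X \<rho> (Neg \<phi>) e \<longleftrightarrow> \<not> sat X \<rho> \<phi> e"
| "sat X \<rho> (All v \<phi>) e \<longleftrightarrow> (\<forall>x\<in>X. sat X \<rho> \<phi> (e(v := x)))"
| "sat X \<rho> (Ex v \<phi>) e \<longleftrightarrow> (\<exists>x\<in>X. sat X \<rho> \<phi> (e(v := x)))"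
| "sat X \<rho> (Conj J F) e \<longleftrightarrow> (\<forall>j\<in>J. sat X \<rho> (F j) e)"
| "sat X \<rho> (Disj J F) e \<longleftrightarrow> (\<exists>j\<in>J. sat X \<rho> (F j) e)"

definition models :: "'a set \<Rightarrow> ('i \<Rightarrow> 'a list set) \<Rightarrow> ('i, 'v, 'k) fm set \<Rightarrow> bool" where
  "models X \<rho> T \<longleftrightarrow> (\<forall>\<phi>\<in>T. \<forall>e. range e \<subseteq> X \<longrightarrow> sat X \<rho> \<phi> e)"

definition model_interpretations ::
  "'i set \<Rightarrow> ('i \<Rightarrow> nat) \<Rightarrow> ('i, 'v, 'k) fm set \<Rightarrow> 'a set \<Rightarrow> ('i \<Rightarrow> 'a list set) set" where
  "model_interpretations I ar T X = {\<rho> \<in> interpretations I ar X. models X \<rho> T}"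

definition int_le :: "'i set \<Rightarrow> ('i \<Rightarrow> 'a list set) \<Rightarrow> ('i \<Rightarrow> 'a list set) \<Rightarrow> bool" where
  "int_le I \<rho> \<sigma> \<longleftrightarrow> (\<forall>i\<in>I. \<rho> i \<subseteq> \<sigma> i)"

definition int_Union :: "'i set \<Rightarrow> ('i \<Rightarrow> 'a list set) set \<Rightarrow> 'i \<Rightarrow> 'a list set" where
  "int_Union I C = (\<lambda>i\<in>I. \<Union>\<rho>\<in>C. \<rho> i)"

definition int_Inter :: "'i set \<Rightarrow> ('i \<Rightarrow> 'a list set) set \<Rightarrow> 'i \<Rightarrow> 'a list set" where
  "int_Inter I C = (\<lambda>i\<in>I. \<Inter>\<rho>\<in>C. \<rho> i)"

text \<open>
  Only non-empty chains are considered: the union and the intersection of the empty chain are the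
  least and the greatest interpretation, which need not belong to \<open>P\<close>.  (In HOL, \<open>\<Inter>{}\<close> would moreover
  be \<open>UNIV\<close>.)
\<close>

definition union_complete :: "'i set \<Rightarrow> ('i \<Rightarrow> 'a list set) set \<Rightarrow> bool" where
  "union_complete I P \<longleftrightarrow>
     (\<forall>C. C \<subseteq> P \<and> C \<noteq> {} \<and> Complete_Partial_Order.chain (int_le I) C \<longrightarrow> int_Union I C \<in> P)"

definition inter_complete :: "'i set \<Rightarrow> ('i \<Rightarrow> 'a list set) set \<Rightarrow> bool" where
  "inter_complete I P \<longleftrightarrow>
     (\<forall>C. C \<subseteq> P \<and> C \<noteq> {} \<and> Complete_Partial_Order.chain (int_le I) C \<longrightarrow> int_Inter I C \<in> P)"

definition maximal_elements :: "'i set \<Rightarrow> ('i \<Rightarrow> 'a list set) set \<Rightarrow> ('i \<Rightarrow> 'a list set) set" where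
  "maximal_elements I P = {\<rho> \<in> P. \<forall>\<sigma>\<in>P. int_le I \<rho> \<sigma> \<longrightarrow> \<sigma> = \<rho>}"

definition minimal_elements :: "'i set \<Rightarrow> ('i \<Rightarrow> 'a list set) set \<Rightarrow> ('i \<Rightarrow> 'a list set) set" where
  "minimal_elements I P = {\<rho> \<in> P. \<forall>\<sigma>\<in>P. int_le I \<sigma> \<rho> \<longrightarrow> \<sigma> = \<rho>}"

definition dense_in :: "'i set \<Rightarrow> ('i \<Rightarrow> 'a list set) set \<Rightarrow> ('i \<Rightarrow> 'a list set) set \<Rightarrow> bool" where
  "dense_in I P D \<longleftrightarrow> D \<subseteq> P \<and> (\<forall>\<rho>\<in>P. \<exists>\<delta>\<in>D. int_le I \<delta> \<rho>)"

definition codense_in :: "'i set \<Rightarrow> ('i \<Rightarrow> 'a list set) set \<Rightarrow> ('i \<Rightarrow> 'a list set) set \<Rightarrow> bool" where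
  "codense_in I P D \<longleftrightarrow> D \<subseteq> P \<and> (\<forall>\<rho>\<in>P. \<exists>\<delta>\<in>D. int_le I \<rho> \<delta>)"

definition endomorphism :: "'i set \<Rightarrow> 'a set \<Rightarrow> ('i \<Rightarrow> 'a list set) \<Rightarrow> ('a \<Rightarrow> 'a) \<Rightarrow> bool" where
  "endomorphism I X \<rho> f \<longleftrightarrow> f ` X \<subseteq> X \<and> (\<forall>i\<in>I. \<forall>xs\<in>\<rho> i. map f xs \<in> \<rho> i)"

definition automorphism ::
  "'i set \<Rightarrow> ('i \<Rightarrow> nat) \<Rightarrow> 'a set \<Rightarrow> ('i \<Rightarrow> 'a list set) \<Rightarrow> ('a \<Rightarrow> 'a) \<Rightarrow> bool" where
  "automorphism I ar X \<rho> f \<longleftrightarrow>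
     bij_betw f X X \<and> (\<forall>i\<in>I. \<forall>xs\<in>tuples X (ar i). xs \<in> \<rho> i \<longleftrightarrow> map f xs \<in> \<rho> i)"

definition reversible ::
  "'i set \<Rightarrow> ('i \<Rightarrow> nat) \<Rightarrow> 'a set \<Rightarrow> ('i \<Rightarrow> 'a list set) \<Rightarrow> bool" where
  "reversible I ar X \<rho> \<longleftrightarrow>
     (\<forall>f. endomorphism I X \<rho> f \<and> bij_betw f X X \<longrightarrow> automorphism I ar X \<rho> f)"

end

theory Submission
  imports Defs
begin

text \<open>
  Along a chain, a formula of \<open>\<F>\<close> that fails in the union fails in all sufficiently large members:
  a single tuple or index witnesses the failure, and finitely many tails of a chain have a common
  one.  Dually a formula of \<open>\<not>\<F>\<close> true in the union is eventually true, so
  \<open>\<forall>v. \<exists>\<^sub>\<le>\<^sub>n w. \<phi>\<close> behaves like a formula of \<open>\<F>\<close> and its models are closed under unions of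
  chains; Zorn's lemma yields co-density.  A bijective endomorphism \<open>f\<close> of \<open>\<rho>\<close> makes the preimage
  of \<open>\<rho>\<close> under \<open>f\<close> an isomorphic, hence admissible, interpretation above \<open>\<rho>\<close>, and maximality forces
  equality.  Part (b) is symmetric, with the image in place of the preimage.
\<close>

section \<open>Formulas of the counting axiom\<close>

text \<open>The counting axiom contains copies of \<phi> with permuted variables. Each syntactic
  class is blind to the names of variables, so what is assumed of \<phi> holds of its copies
  too.\<close>

lemma rename_formulas: "\<phi> \<in> formulas I ar \<Longrightarrow> rename f \<phi> \<in> formulas I ar"
  by (induction rule: formulas.induct) (auto intro: formulas.intros)

lemma rename_class_P: "\<phi> \<in> class_P I ar \<Longrightarrow> rename f \<phi> \<in> class_P I ar"
  by (induction rule: class_P.induct) (auto intro: class_P.intros)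

lemma rename_class_N: "\<phi> \<in> class_N I ar \<Longrightarrow> rename f \<phi> \<in> class_N I ar"
  by (induction rule: class_N.induct) (auto intro: class_N.intros)

lemma rename_class_not_F: "\<phi> \<in> class_not_F I ar \<Longrightarrow> rename f \<phi> \<in> class_not_F I ar"
  by (induction rule: class_not_F.induct) (auto intro: class_not_F.intros rename_class_N)

lemma rename_class_not_G: "\<phi> \<in> class_not_G I ar \<Longrightarrow> rename f \<phi> \<in> class_not_G I ar"
  by (induction rule: class_not_G.induct) (auto intro: class_not_G.intros rename_class_P)

lemma Alls_formulas: "\<phi> \<in> formulas I ar \<Longrightarrow> Alls vs \<phi> \<in> formulas I ar"
  unfolding Alls_def by (induction vs) (auto intro: formulas.intros)

lemma conj_list_formulas: "set \<phi>s \<subseteq> formulas I ar \<Longrightarrow> conj_list \<phi>s \<in> formulas I ar"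
  unfolding conj_list_def by (rule formulas.intros) (auto simp: subset_iff)

lemma disj_list_formulas: "set \<phi>s \<subseteq> formulas I ar \<Longrightarrow> disj_list \<phi>s \<in> formulas I ar"
  unfolding disj_list_def by (rule formulas.intros) (auto simp: subset_iff)

lemma all_at_most_formulas:
  assumes "\<phi> \<in> formulas I ar"
  shows "all_at_most n vs ws W \<phi> \<in> formulas I ar"
  unfolding all_at_most_def
  by (intro Alls_formulas disj_list_formulas)
    (auto intro!: formulas.intros(3) rename_formulas conj_list_formulas assms formulas.intros(1))

section \<open>Truth in a limit of interpretations\<close>

text \<open>The filter stands for "all sufficiently late members of the chain", so one calculus
  serves unions and intersections. The eventuality may depend on \<open>e\<close>; hence one witness
  handles \<open>Ex\<close> and any \<open>Disj\<close>, while \<open>Conj\<close> needs a finite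
  index set.\<close>

definition open_at ::
  "'a set \<Rightarrow> ('i \<Rightarrow> 'a list set) \<Rightarrow> ('i \<Rightarrow> 'a list set) filter \<Rightarrow> ('i, 'v, 'k) fm \<Rightarrow> bool" where
  "open_at X U \<F> \<phi> \<longleftrightarrow> (\<forall>e. sat X U \<phi> e \<longrightarrow> (\<forall>\<^sub>F \<rho> in \<F>. sat X \<rho> \<phi> e))"

definition closed_at ::
  "'a set \<Rightarrow> ('i \<Rightarrow> 'a list set) \<Rightarrow> ('i \<Rightarrow> 'a list set) filter \<Rightarrow> ('i, 'v, 'k) fm \<Rightarrow> bool" where
  "closed_at X U \<F> \<phi> \<longleftrightarrow> (\<forall>e. \<not> sat X U \<phi> e \<longrightarrow> (\<forall>\<^sub>F \<rho> in \<F>. \<not> sat X \<rho> \<phi> e))"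

lemma open_at_Ex: "open_at X U \<F> \<phi> \<Longrightarrow> open_at X U \<F> (Ex v \<phi>)"
  unfolding open_at_def by (fastforce elim: eventually_mono)

lemma open_at_Disj: "(\<And>j. j \<in> J \<Longrightarrow> open_at X U \<F> (F j)) \<Longrightarrow> open_at X U \<F> (Disj J F)"
  unfolding open_at_def by (fastforce elim: eventually_mono)

lemma open_at_Conj:
  "finite J \<Longrightarrow> (\<And>j. j \<in> J \<Longrightarrow> open_at X U \<F> (F j)) \<Longrightarrow> open_at X U \<F> (Conj J F)"
  unfolding open_at_def by (simp add: eventually_ball_finite)

lemma closed_at_All: "closed_at X U \<F> \<phi> \<Longrightarrow> closed_at X U \<F> (All v \<phi>)"
  unfolding closed_at_def by (fastforce elim: eventually_mono)

lemma closed_at_Conj: "(\<And>j. j \<in> J \<Longrightarrow> closed_at X U \<F> (F j)) \<Longrightarrow> closed_at X U \<F> (Conj J F)"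
  unfolding closed_at_def by (fastforce elim: eventually_mono)

lemma closed_at_Disj:
  "finite J \<Longrightarrow> (\<And>j. j \<in> J \<Longrightarrow> closed_at X U \<F> (F j)) \<Longrightarrow> closed_at X U \<F> (Disj J F)"
  unfolding closed_at_def by (simp add: eventually_ball_finite)

lemma closed_at_Neg: "open_at X U \<F> \<phi> \<Longrightarrow> closed_at X U \<F> (Neg \<phi>)"
  unfolding open_at_def closed_at_def by simp

lemma closed_at_Eq: "closed_at X U \<F> (Eq a b)"
  unfolding closed_at_def by simp

lemma closed_at_Alls: "closed_at X U \<F> \<phi> \<Longrightarrow> closed_at X U \<F> (Alls vs \<phi>)"
  unfolding Alls_def by (induction vs) (auto intro: closed_at_All)

lemma closed_at_conj_list:
  "(\<And>\<phi>. \<phi> \<in> set \<phi>s \<Longrightarrow> closed_at X U \<F> \<phi>) \<Longrightarrow> closed_at X U \<F> (conj_list \<phi>s)"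
  unfolding conj_list_def by (rule closed_at_Conj) auto

lemma closed_at_disj_list:
  "(\<And>\<phi>. \<phi> \<in> set \<phi>s \<Longrightarrow> closed_at X U \<F> \<phi>) \<Longrightarrow> closed_at X U \<F> (disj_list \<phi>s)"
  unfolding disj_list_def by (rule closed_at_Disj) auto

text \<open>Under a universal prefix stands a finite disjunction of negated copies of \<phi> and of
  tuple equalities; the former are closed because the copies are open, and the latter do not depend
  on the interpretation.\<close>

lemma closed_at_all_at_most:
  fixes \<phi> :: "('i, 'v, 'k) fm"
  assumes "\<And>f :: 'v \<Rightarrow> 'v. open_at X U \<F> (rename f \<phi>)"
  shows "closed_at X U \<F> (all_at_most n vs ws W \<phi>)"
  unfolding all_at_most_def
  by (intro closed_at_Alls closed_at_disj_list)
    (auto intro!: closed_at_Neg closed_at_conj_list closed_at_Eq assms)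

text \<open>A failure in \<open>U\<close> under some \<open>e\<close> would be an eventual failure
  under the same \<open>e\<close>, against eventual truth; a proper filter does not admit
  both.\<close>

lemma models_limit:
  assumes "\<F> \<noteq> bot" and "\<And>\<phi>. \<phi> \<in> T \<Longrightarrow> closed_at X U \<F> \<phi>" and "\<forall>\<^sub>F \<rho> in \<F>. models X \<rho> T"
  shows "models X U T"
  unfolding models_def
proof (intro ballI allI impI, rule ccontr)
  fix \<phi> e
  assume *: "\<phi> \<in> T" "range e \<subseteq> X" "\<not> sat X U \<phi> e"
  then have "\<forall>\<^sub>F \<rho> in \<F>. \<not> sat X \<rho> \<phi> e"
    using assms(2) unfolding closed_at_def by blast
  moreover have "\<forall>\<^sub>F \<rho> in \<F>. sat X \<rho> \<phi> e"
    using assms(3) by eventually_elim (use * in \<open>auto simp: models_def\<close>)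
  ultimately have "\<forall>\<^sub>F \<rho> in \<F>. False"
    by eventually_elim simp
  then show False
    using assms(1) by (simp add: trivial_limit_def)
qed

section \<open>Monotone formulas, and the classes F and G in limits from below and from
  above\<close>

text \<open>Negation meets only equalities here, and these do not see the interpretation.\<close>

lemma sat_class_P_mono:
  "\<phi> \<in> class_P I ar \<Longrightarrow> int_le I \<rho> \<sigma> \<Longrightarrow> sat X \<rho> \<phi> e \<Longrightarrow> sat X \<sigma> \<phi> e"
  by (induction arbitrary: e rule: class_P.induct) (auto simp: int_le_def)

lemma sat_class_N_antimono:
  "\<phi> \<in> class_N I ar \<Longrightarrow> int_le I \<rho> \<sigma> \<Longrightarrow> sat X \<sigma> \<phi> e \<Longrightarrow> sat X \<rho> \<phi> e"
  by (induction arbitrary: e rule: class_N.induct) (auto simp: int_le_def)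

text \<open>The filter converges to \<open>U\<close> from below. What is true of some \<rho> below
  \<open>U\<close> by a formula of \<open>class_P\<close> is true of \<open>U\<close>, so failure in
  \<open>U\<close> goes down to \<rho>; likewise truth of a formula of \<open>class_N\<close> goes
  down. The added literals concern one tuple of \<open>U\<close>, which \<open>mem\<close> puts into
  \<rho> eventually.\<close>

lemma
  assumes le: "\<forall>\<^sub>F \<rho> in \<F>. int_le I \<rho> U"
    and mem: "\<And>i xs. i \<in> I \<Longrightarrow> xs \<in> U i \<Longrightarrow> \<forall>\<^sub>F \<rho> in \<F>. xs \<in> \<rho> i"
  shows closed_at_class_F: "\<phi> \<in> class_F I ar \<Longrightarrow> closed_at X U \<F> \<phi>"
    and open_at_class_not_F: "\<psi> \<in> class_not_F I ar \<Longrightarrow> open_at X U \<F> \<psi>"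
proof -
  show "closed_at X U \<F> \<phi>" if "\<phi> \<in> class_F I ar"
    using that
  proof (induction rule: class_F.induct)
    case (1 \<phi>)
    show ?case
      unfolding closed_at_def using le sat_class_P_mono[OF 1] by (blast intro: eventually_mono)
  next
    case (2 i vs)
    then show ?case
      using mem by (simp add: closed_at_def)
  qed (auto intro: closed_at_All closed_at_Conj closed_at_Disj)
  show "open_at X U \<F> \<psi>" if "\<psi> \<in> class_not_F I ar"
    using that
  proof (induction rule: class_not_F.induct)
    case (1 \<phi>)
    show ?case
      unfolding open_at_def using le sat_class_N_antimono[OF 1] by (blast intro: eventually_mono)
  next
    case (2 i vs)
    then show ?case
      using mem by (simp add: open_at_def)
  qed (auto intro: open_at_Ex open_at_Conj open_at_Disj)
qed

text \<open>Dual situation: convergence from above, with \<open>class_P\<close> and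
  \<open>class_N\<close> exchanged. The added literals now concern one tuple outside
  \<open>U\<close>, which is eventually outside \<rho>.\<close>

lemma
  assumes le: "\<forall>\<^sub>F \<rho> in \<F>. int_le I U \<rho>"
    and mem: "\<And>i xs. i \<in> I \<Longrightarrow> xs \<notin> U i \<Longrightarrow> \<forall>\<^sub>F \<rho> in \<F>. xs \<notin> \<rho> i"
  shows closed_at_class_G: "\<phi> \<in> class_G I ar \<Longrightarrow> closed_at X U \<F> \<phi>"
    and open_at_class_not_G: "\<psi> \<in> class_not_G I ar \<Longrightarrow> open_at X U \<F> \<psi>"
proof -
  show "closed_at X U \<F> \<phi>" if "\<phi> \<in> class_G I ar"
    using that
  proof (induction rule: class_G.induct)
    case (1 \<phi>)
    show ?case
      unfolding closed_at_def using le sat_class_N_antimono[OF 1] by (blast intro: eventually_mono)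
  next
    case (2 i vs)
    then show ?case
      using mem by (simp add: closed_at_def)
  qed (auto intro: closed_at_All closed_at_Conj closed_at_Disj)
  show "open_at X U \<F> \<psi>" if "\<psi> \<in> class_not_G I ar"
    using that
  proof (induction rule: class_not_G.induct)
    case (1 \<phi>)
    show ?case
      unfolding open_at_def using le sat_class_P_mono[OF 1] by (blast intro: eventually_mono)
  next
    case (2 i vs)
    then show ?case
      using mem by (simp add: open_at_def)
  qed (auto intro: open_at_Ex open_at_Conj open_at_Disj)
qed

section \<open>Unions and intersections of chains\<close>

definition tails :: "('b \<Rightarrow> 'b \<Rightarrow> bool) \<Rightarrow> 'b set \<Rightarrow> 'b filter" where
  "tails r C = (INF x\<in>C. principal {y \<in> C. r x y})"

text \<open>The tails of a chain form a filter base: the tail of the later of two elements lies in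
  both tails by transitivity.\<close>

lemma eventually_tails:
  assumes "C \<noteq> {}" "Complete_Partial_Order.chain r C" "transp r"
  shows "eventually Q (tails r C) \<longleftrightarrow> (\<exists>x\<in>C. \<forall>y\<in>C. r x y \<longrightarrow> Q y)"
proof -
  have "\<exists>z\<in>C. principal {y \<in> C. r z y} \<le> inf (principal {y \<in> C. r a y}) (principal {y \<in> C. r b y})"
    if "a \<in> C" "b \<in> C" for a b
    using chainD[OF assms(2) that]
  proof
    assume "r a b"
    then have "principal {y \<in> C. r b y} \<le> inf (principal {y \<in> C. r a y}) (principal {y \<in> C. r b y})"
      using transpD[OF assms(3)] by auto
    then show ?thesis
      using that(2) by blast
  next
    assume "r b a"
    then have "principal {y \<in> C. r a y} \<le> inf (principal {y \<in> C. r a y}) (principal {y \<in> C. r b y})"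
      using transpD[OF assms(3)] by auto
    then show ?thesis
      using that(1) by blast
  qed
  then show ?thesis
    unfolding tails_def by (subst eventually_INF_base[OF assms(1)]) (auto simp: eventually_principal)
qed

lemma int_le_refl: "int_le I \<rho> \<rho>"
  by (simp add: int_le_def)

lemma int_le_trans: "int_le I \<rho> \<sigma> \<Longrightarrow> int_le I \<sigma> \<tau> \<Longrightarrow> int_le I \<rho> \<tau>"
  unfolding int_le_def by blast

text \<open>\<open>int_le\<close> compares only indices in \<open>I\<close>; at all others both
  functions are \<open>undefined\<close> by extensionality.\<close>

lemma int_le_antisym:
  assumes "\<rho> \<in> interpretations I ar X" "\<sigma> \<in> interpretations I ar X" "int_le I \<rho> \<sigma>" "int_le I \<sigma> \<rho>"
  shows "\<rho> = \<sigma>"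
  using assms(1,2)[unfolded interpretations_def]
proof (rule PiE_ext)
  show "\<rho> i = \<sigma> i" if "i \<in> I" for i
    using assms(3,4) that unfolding int_le_def by blast
qed

lemma int_Union_interpretations:
  "C \<subseteq> interpretations I ar X \<Longrightarrow> int_Union I C \<in> interpretations I ar X"
  unfolding interpretations_def int_Union_def by fastforce

lemma int_Inter_interpretations:
  "C \<subseteq> interpretations I ar X \<Longrightarrow> C \<noteq> {} \<Longrightarrow> int_Inter I C \<in> interpretations I ar X"
  unfolding interpretations_def int_Inter_def by fastforce

lemma union_complete_model_interpretations:
  fixes \<phi> :: "('i, 'v, 'k) fm"
  assumes "\<phi> \<in> class_not_F I ar" "T \<subseteq> class_F I ar"
  shows "union_complete I (model_interpretations I ar (T \<union> {all_at_most n vs ws W \<phi>}) X)"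
    (is "union_complete I ?P")
  unfolding union_complete_def
proof (intro allI impI, elim conjE)
  fix C
  assume C: "C \<subseteq> ?P" "C \<noteq> {}" "Complete_Partial_Order.chain (int_le I) C"
  define \<F> where "\<F> = tails (int_le I) C"
  have ev: "eventually Q \<F> \<longleftrightarrow> (\<exists>\<rho>\<in>C. \<forall>\<sigma>\<in>C. int_le I \<rho> \<sigma> \<longrightarrow> Q \<sigma>)" for Q
    unfolding \<F>_def using C int_le_trans by (intro eventually_tails transpI) blast+
  \<comment> \<open>Each tail contains the element at which it starts.\<close>
  have "\<F> \<noteq> bot"
    unfolding trivial_limit_def ev using int_le_refl by blast
  moreover have le: "\<forall>\<^sub>F \<rho> in \<F>. int_le I \<rho> (int_Union I C)"
    unfolding ev using C(2) by (auto simp: int_le_def int_Union_def)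
  \<comment> \<open>A tuple of the union lies in some member of \<open>C\<close>, hence in every
    later one.\<close>
  have mem: "\<forall>\<^sub>F \<rho> in \<F>. xs \<in> \<rho> i" if "i \<in> I" "xs \<in> int_Union I C i" for i xs
    using that unfolding ev int_Union_def int_le_def by auto
  have "closed_at X (int_Union I C) \<F> \<psi>" if "\<psi> \<in> T \<union> {all_at_most n vs ws W \<phi>}" for \<psi>
  proof (cases "\<psi> \<in> T")
    case True
    then have "\<psi> \<in> class_F I ar"
      using assms(2) by blast
    with le mem show ?thesis
      by (rule closed_at_class_F)
  next
    case False
    have "open_at X (int_Union I C) \<F> (rename f \<phi>)" for f :: "'v \<Rightarrow> 'v"
      using le mem rename_class_not_F[OF assms(1)] by (rule open_at_class_not_F)
    then show ?thesis
      using False that closed_at_all_at_most by blast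
  qed
  moreover have "\<forall>\<^sub>F \<rho> in \<F>. models X \<rho> (T \<union> {all_at_most n vs ws W \<phi>})"
    unfolding ev using C(1,2) by (auto simp: model_interpretations_def)
  ultimately have "models X (int_Union I C) (T \<union> {all_at_most n vs ws W \<phi>})"
    by (rule models_limit)
  then show "int_Union I C \<in> ?P"
    using C(1) int_Union_interpretations[of C I ar X] by (auto simp: model_interpretations_def)
qed

lemma inter_complete_model_interpretations:
  fixes \<phi> :: "('i, 'v, 'k) fm"
  assumes "\<phi> \<in> class_not_G I ar" "T \<subseteq> class_G I ar"
  shows "inter_complete I (model_interpretations I ar (T \<union> {all_at_most n vs ws W \<phi>}) X)"
    (is "inter_complete I ?P")
  unfolding inter_complete_def
proof (intro allI impI, elim conjE)
  fix C
  assume C: "C \<subseteq> ?P" "C \<noteq> {}" "Complete_Partial_Order.chain (int_le I) C"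
  \<comment> \<open>The order is reversed, so that a tail consists of the members below a given
    one.\<close>
  define \<F> where "\<F> = tails (\<lambda>\<rho> \<sigma>. int_le I \<sigma> \<rho>) C"
  have ev: "eventually Q \<F> \<longleftrightarrow> (\<exists>\<rho>\<in>C. \<forall>\<sigma>\<in>C. int_le I \<sigma> \<rho> \<longrightarrow> Q \<sigma>)" for Q
    unfolding \<F>_def using C int_le_trans
    by (intro eventually_tails transpI) (blast intro: chainI dest: chainD)+
  have "\<F> \<noteq> bot"
    unfolding trivial_limit_def ev using int_le_refl by blast
  moreover have le: "\<forall>\<^sub>F \<rho> in \<F>. int_le I (int_Inter I C) \<rho>"
    unfolding ev using C(2) by (auto simp: int_le_def int_Inter_def)
  \<comment> \<open>A tuple outside the intersection is missed by some member of \<open>C\<close>,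
    hence by every smaller one.\<close>
  have mem: "\<forall>\<^sub>F \<rho> in \<F>. xs \<notin> \<rho> i" if "i \<in> I" "xs \<notin> int_Inter I C i" for i xs
    using that unfolding ev int_Inter_def int_le_def by auto
  have "closed_at X (int_Inter I C) \<F> \<psi>" if "\<psi> \<in> T \<union> {all_at_most n vs ws W \<phi>}" for \<psi>
  proof (cases "\<psi> \<in> T")
    case True
    then have "\<psi> \<in> class_G I ar"
      using assms(2) by blast
    with le mem show ?thesis
      by (rule closed_at_class_G)
  next
    case False
    have "open_at X (int_Inter I C) \<F> (rename f \<phi>)" for f :: "'v \<Rightarrow> 'v"
      using le mem rename_class_not_G[OF assms(1)] by (rule open_at_class_not_G)
    then show ?thesis
      using False that closed_at_all_at_most by blast
  qed
  moreover have "\<forall>\<^sub>F \<rho> in \<F>. models X \<rho> (T \<union> {all_at_most n vs ws W \<phi>})"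
    unfolding ev using C(1,2) by (auto simp: model_interpretations_def)
  ultimately have "models X (int_Inter I C) (T \<union> {all_at_most n vs ws W \<phi>})"
    by (rule models_limit)
  then show "int_Inter I C \<in> ?P"
    using C(1,2) int_Inter_interpretations[of C I ar X] by (auto simp: model_interpretations_def)
qed

section \<open>Density of the extremal elements\<close>

lemma codense_maximal_elements:
  assumes "P \<subseteq> interpretations I ar X" "union_complete I P"
  shows "codense_in I P (maximal_elements I P)"
  unfolding codense_in_def
proof (intro conjI ballI)
  fix \<rho> assume \<rho>: "\<rho> \<in> P"
  \<comment> \<open>Zorn's lemma is applied only to the elements above \<rho>; an element maximal
    among them is maximal in \<open>P\<close>, as everything above it is again above \<rho>.\<close>
  let ?A = "{\<sigma> \<in> P. int_le I \<rho> \<sigma>}"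
  have "partial_order_on ?A (relation_of (int_le I) ?A)"
    using assms(1) int_le_refl int_le_trans int_le_antisym
    by (intro partial_order_on_relation_ofI) blast+
  moreover have "\<exists>u\<in>?A. \<forall>\<sigma>\<in>C. int_le I \<sigma> u" if "C \<in> Chains (relation_of (int_le I) ?A)" for C
  proof (cases "C = {}")
    \<comment> \<open>The empty chain is not covered by \<open>union_complete\<close>; \<rho> itself
      bounds it.\<close>
    case True
    then show ?thesis
      using \<rho> int_le_refl by blast
  next
    case False
    have C: "C \<subseteq> ?A" "Complete_Partial_Order.chain (int_le I) C"
      using that by (auto simp: Chains_def relation_of_def chain_def)
    then have "int_Union I C \<in> P"
      using assms(2) False unfolding union_complete_def by blast
    moreover have upper: "\<forall>\<sigma>\<in>C. int_le I \<sigma> (int_Union I C)"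
      by (auto simp: int_le_def int_Union_def)
    moreover have "int_le I \<rho> (int_Union I C)"
      using upper False C(1) int_le_trans by blast
    ultimately show ?thesis
      by blast
  qed
  ultimately obtain m where "m \<in> ?A" "\<forall>\<sigma>\<in>?A. int_le I m \<sigma> \<longrightarrow> \<sigma> = m"
    using predicate_Zorn by blast
  then show "\<exists>\<delta>\<in>maximal_elements I P. int_le I \<rho> \<delta>"
    unfolding maximal_elements_def using int_le_trans by blast
qed (auto simp: maximal_elements_def)

lemma dense_minimal_elements:
  assumes "P \<subseteq> interpretations I ar X" "inter_complete I P"
  shows "dense_in I P (minimal_elements I P)"
  unfolding dense_in_def
proof (intro conjI ballI)
  fix \<rho> assume \<rho>: "\<rho> \<in> P"
  \<comment> \<open>The same argument below \<rho>, with Zorn's lemma for the reversed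
    order.\<close>
  let ?A = "{\<sigma> \<in> P. int_le I \<sigma> \<rho>}" and ?r = "\<lambda>\<sigma> \<tau>. int_le I \<tau> \<sigma>"
  have "partial_order_on ?A (relation_of ?r ?A)"
    using assms(1) int_le_refl int_le_trans int_le_antisym
    by (intro partial_order_on_relation_ofI) blast+
  moreover have "\<exists>u\<in>?A. \<forall>\<sigma>\<in>C. int_le I u \<sigma>" if "C \<in> Chains (relation_of ?r ?A)" for C
  proof (cases "C = {}")
    case True
    then show ?thesis
      using \<rho> int_le_refl by blast
  next
    case False
    have C: "C \<subseteq> ?A" "Complete_Partial_Order.chain (int_le I) C"
      using that by (auto simp: Chains_def relation_of_def chain_def)
    then have "int_Inter I C \<in> P"
      using assms(2) False unfolding inter_complete_def by blast
    moreover have lower: "\<forall>\<sigma>\<in>C. int_le I (int_Inter I C) \<sigma>"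
      by (auto simp: int_le_def int_Inter_def)
    moreover have "int_le I (int_Inter I C) \<rho>"
      using lower False C(1) int_le_trans by blast
    ultimately show ?thesis
      by blast
  qed
  ultimately obtain m where "m \<in> ?A" "\<forall>\<sigma>\<in>?A. int_le I \<sigma> m \<longrightarrow> \<sigma> = m"
    using predicate_Zorn[of ?A ?r] by blast
  then show "\<exists>\<delta>\<in>minimal_elements I P. int_le I \<delta> \<rho>"
    unfolding minimal_elements_def using int_le_trans by blast
qed (auto simp: minimal_elements_def)

section \<open>Reversibility of the extremal elements\<close>

text \<open>For a bijection \<open>f\<close> of \<open>X\<close>, this is the structure that makes
  \<open>f\<close> an isomorphism onto the structure given by \<rho>.\<close>

definition pullback ::
  "'i set \<Rightarrow> ('i \<Rightarrow> nat) \<Rightarrow> 'a set \<Rightarrow> ('a \<Rightarrow> 'a) \<Rightarrow> ('i \<Rightarrow> 'a list set) \<Rightarrow> 'i \<Rightarrow> 'a list set" where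
  "pullback I ar X f \<rho> = (\<lambda>i\<in>I. {xs \<in> tuples X (ar i). map f xs \<in> \<rho> i})"

text \<open>Isomorphisms preserve all formulas: injectivity settles equalities, and surjectivity
  lets quantifiers be reindexed along \<open>f\<close>.\<close>

lemma sat_pullback:
  assumes "bij_betw f X X"
  shows "\<phi> \<in> formulas I ar \<Longrightarrow> range e \<subseteq> X \<Longrightarrow>
    sat X (pullback I ar X f \<rho>) \<phi> e \<longleftrightarrow> sat X \<rho> \<phi> (f \<circ> e)"
proof (induction arbitrary: e rule: formulas.induct)
  case (1 a b)
  then show ?case
    using inj_on_eq_iff[OF bij_betw_imp_inj_on[OF assms], of "e a" "e b"] by auto
next
  case (2 i vs)
  then show ?case
    by (auto simp: pullback_def tuples_def comp_def)
next
  case (4 \<phi> v)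
  have "sat X (pullback I ar X f \<rho>) \<phi> (e(v := x)) \<longleftrightarrow> sat X \<rho> \<phi> ((f \<circ> e)(v := f x))"
    if "x \<in> X" for x
  proof -
    have "range (e(v := x)) \<subseteq> X"
      using "4.prems" that by auto
    from "4.IH"[OF this] show ?thesis
      by (simp only: fun_upd_comp)
  qed
  then have "sat X (pullback I ar X f \<rho>) (All v \<phi>) e \<longleftrightarrow> (\<forall>y\<in>f ` X. sat X \<rho> \<phi> ((f \<circ> e)(v := y)))"
    by simp
  then show ?case
    by (simp only: sat.simps bij_betw_imp_surj_on[OF assms])
next
  case (5 \<phi> v)
  have "sat X (pullback I ar X f \<rho>) \<phi> (e(v := x)) \<longleftrightarrow> sat X \<rho> \<phi> ((f \<circ> e)(v := f x))"
    if "x \<in> X" for x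
  proof -
    have "range (e(v := x)) \<subseteq> X"
      using "5.prems" that by auto
    from "5.IH"[OF this] show ?thesis
      by (simp only: fun_upd_comp)
  qed
  then have "sat X (pullback I ar X f \<rho>) (Ex v \<phi>) e \<longleftrightarrow> (\<exists>y\<in>f ` X. sat X \<rho> \<phi> ((f \<circ> e)(v := y)))"
    by simp
  then show ?case
    by (simp only: sat.simps bij_betw_imp_surj_on[OF assms])
qed auto

lemma pullback_model_interpretations:
  assumes "bij_betw f X X" "T \<subseteq> formulas I ar" "\<rho> \<in> model_interpretations I ar T X"
  shows "pullback I ar X f \<rho> \<in> model_interpretations I ar T X"
proof -
  have "sat X (pullback I ar X f \<rho>) \<phi> e" if "\<phi> \<in> T" "range e \<subseteq> X" for \<phi> e
  proof -
    have "range (f \<circ> e) \<subseteq> X"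
      using that(2) bij_betw_imp_surj_on[OF assms(1)] by auto
    then have "sat X \<rho> \<phi> (f \<circ> e)"
      using assms(3) that(1) unfolding model_interpretations_def models_def by blast
    then show ?thesis
      using sat_pullback[OF assms(1)] assms(2) that by blast
  qed
  then show ?thesis
    by (auto simp: model_interpretations_def models_def interpretations_def pullback_def)
qed

lemma pullback_fixed_mem_iff:
  assumes "pullback I ar X f \<rho> = \<rho>" "i \<in> I" "xs \<in> tuples X (ar i)"
  shows "xs \<in> \<rho> i \<longleftrightarrow> map f xs \<in> \<rho> i"
proof -
  have "xs \<in> pullback I ar X f \<rho> i \<longleftrightarrow> map f xs \<in> \<rho> i"
    using assms(2,3) by (simp add: pullback_def)
  then show ?thesis
    unfolding assms(1) .
qed

lemma reversible_maximal_elements: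
  assumes "T \<subseteq> formulas I ar" "\<rho> \<in> maximal_elements I (model_interpretations I ar T X)"
  shows "reversible I ar X \<rho>"
  unfolding reversible_def
proof (intro allI impI, elim conjE)
  fix f assume f: "endomorphism I X \<rho> f" "bij_betw f X X"
  have \<rho>: "\<rho> \<in> model_interpretations I ar T X"
    using assms(2) by (simp add: maximal_elements_def)
  \<comment> \<open>This is the endomorphism property, read as an inclusion.\<close>
  have "int_le I \<rho> (pullback I ar X f \<rho>)"
    using f(1) \<rho>
    by (auto simp: int_le_def pullback_def endomorphism_def model_interpretations_def
        interpretations_def)
  then have eq: "pullback I ar X f \<rho> = \<rho>"
    using assms(2) pullback_model_interpretations[OF f(2) assms(1) \<rho>]
    by (simp add: maximal_elements_def)
  show "automorphism I ar X \<rho> f"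
    unfolding automorphism_def using f(2) pullback_fixed_mem_iff[OF eq] by blast
qed

lemma reversible_minimal_elements:
  assumes "T \<subseteq> formulas I ar" "\<rho> \<in> minimal_elements I (model_interpretations I ar T X)"
  shows "reversible I ar X \<rho>"
  unfolding reversible_def
proof (intro allI impI, elim conjE)
  fix f assume f: "endomorphism I X \<rho> f" "bij_betw f X X"
  \<comment> \<open>Pulling back along the inverse of \<open>f\<close> gives the image of \<rho>
    under \<open>f\<close>, which the endomorphism property places below \<rho>.\<close>
  define g where "g = inv_into X f"
  have g: "bij_betw g X X"
    unfolding g_def using f(2) by (rule bij_betw_inv_into)
  have fg: "map f (map g xs) = xs" and gf: "map g (map f xs) = xs" if "set xs \<subseteq> X" for xs
    using that bij_betw_inv_into_right[OF f(2)] bij_betw_inv_into_left[OF f(2)]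
    by (auto simp: g_def intro!: map_idI)
  have \<rho>: "\<rho> \<in> model_interpretations I ar T X"
    using assms(2) by (simp add: minimal_elements_def)
  have "xs \<in> \<rho> i" if "i \<in> I" "set xs \<subseteq> X" "map g xs \<in> \<rho> i" for i xs
    using f(1) that fg[OF that(2)] unfolding endomorphism_def by metis
  then have "int_le I (pullback I ar X g \<rho>) \<rho>"
    by (auto simp: int_le_def pullback_def tuples_def)
  then have eq: "pullback I ar X g \<rho> = \<rho>"
    using assms(2) pullback_model_interpretations[OF g assms(1) \<rho>]
    by (simp add: minimal_elements_def)
  show "automorphism I ar X \<rho> f"
    unfolding automorphism_def
  proof (intro conjI ballI)
    fix i xs assume i: "i \<in> I" and xs: "xs \<in> tuples X (ar i)"
    then have "map f xs \<in> tuples X (ar i)"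
      using bij_betw_imp_surj_on[OF f(2)] by (auto simp: tuples_def)
    moreover have "map g (map f xs) = xs"
      using gf xs by (simp add: tuples_def)
    \<comment> \<open>The fixed-point equation for \<open>g\<close> is read at the tuple
      \<open>map f xs\<close>, which \<open>g\<close> sends back to \<open>xs\<close>.\<close>
    ultimately show "xs \<in> \<rho> i \<longleftrightarrow> map f xs \<in> \<rho> i"
      using pullback_fixed_mem_iff[OF eq i, of "map f xs"] by simp
  qed (rule f(2))
qed

theorem theorem6p1:
  fixes I :: "'i set" and ar :: "'i \<Rightarrow> nat" and X :: "'a set" and n :: nat
    and vs ws :: "'v list" and W :: "'v list list"
    and \<phi> :: "('i, 'v, 'k) fm" and T :: "('i, 'v, 'k) fm set"
    and P :: "('i \<Rightarrow> 'a list set) set"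
  assumes "X \<noteq> {}"
    and "\<phi> \<in> formulas I ar"
    and "fv \<phi> \<subseteq> set vs \<union> set ws"
    and "T \<subseteq> sentences I ar"
    and "fresh_copies n vs ws W"
    and "P = model_interpretations I ar (T \<union> {all_at_most n vs ws W \<phi>}) X"
    and "P \<noteq> {}"
  shows "(\<phi> \<in> class_not_F I ar \<and> T \<subseteq> class_F I ar \<longrightarrow>
            union_complete I P \<and>
            codense_in I P (maximal_elements I P) \<and>
            (\<forall>\<rho>\<in>maximal_elements I P. reversible I ar X \<rho>))
       \<and> (\<phi> \<in> class_not_G I ar \<and> T \<subseteq> class_G I ar \<longrightarrow>
            inter_complete I P \<and>
            dense_in I P (minimal_elements I P) \<and>
            (\<forall>\<rho>\<in>minimal_elements I P. reversible I ar X \<rho>))"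
proof -
  let ?T = "T \<union> {all_at_most n vs ws W \<phi>}"
  have P: "P \<subseteq> interpretations I ar X"
    using assms(6) by (auto simp: model_interpretations_def)
  \<comment> \<open>Membership in \<open>formulas\<close> is what gives the counting axiom its
    invariance under isomorphism.\<close>
  have T: "?T \<subseteq> formulas I ar"
    using assms(2,4) all_at_most_formulas by (auto simp: sentences_def)
  show ?thesis
    using union_complete_model_interpretations[of \<phi> I ar T n vs ws W X]
      inter_complete_model_interpretations[of \<phi> I ar T n vs ws W X]
      codense_maximal_elements[OF P] dense_minimal_elements[OF P]
      reversible_maximal_elements[OF T, of _ X] reversible_minimal_elements[OF T, of _ X]
    unfolding assms(6)[symmetric] by blast
qed

end
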